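(* Let $N_a, N_v \ge 1$ be integers, let $\mu_P \in \mathbb{R}^{N_a}$, $\nu_V \in \mathbb{R}^{N_v}$, let $C_P \in \mathrm{Sym}^{++}_{N_a}(\mathbb{R})$ and $C_V \in \mathrm{Sym}^{++}_{N_v}(\mathbb{R})$, let $\mathscr{P} \in \mathbb{R}^{N_v \times N_a}$ be an arbitrary real matrix (possibly degenerate, i.e. not of full rank), and let $\lambda \ge 0$. For $m \in \mathbb{R}^{N_a}$ and $C \in \mathrm{Sym}^{++}_{N_a}(\mathbb{R})$ define $$\mathcal{L}_{GWB}(m, C) = \|m - \mu_P\|^2 + \mathrm{tr}\Big(C_P + C - 2\big(C_P^{1/2} C\, C_P^{1/2}\big)^{1/2}\Big) + \lambda\left(\|\mathscr{P} m - \nu_V\|^2 + \mathrm{tr}\Big(C_V + \mathscr{P} C \mathscr{P}^T - 2\big(C_V^{1/2} \mathscr{P} C \mathscr{P}^T C_V^{1/2}\big)^{1/2}\Big)\right).$$ Then $\mathcal{L}_{GWB}$ is minimized over $\mathbb{R}^{N_a} \times \mathrm{Sym}^{++}_{N_a}(\mathbb{R})$ at $(m, C) = (m_\star, C_\star)$, where $$m_\star = W\big(\mu_P + \lambda \mathscr{P}^T \nu_V\big), \qquad W = \big(\mathbb{I}_{N_a} + \lambda \mathscr{P}^T \mathscr{P}\big)^{-1} = W^T,$$ $$C_\star = (W + B)\, C_P\, (W + B),$$ and $B = B^T$ is given by $$B = \lambda\, W A^{-1/2}\big(A^{1/2} \mathscr{P}^T C_V \mathscr{P} A^{1/2}\big)^{1/2}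 A^{-1/2} W, \qquad A = W C_P W.$$
   Context: $\mathrm{Sym}^{++}_{N}(\mathbb{R})$ denotes the set of real symmetric positive definite $N \times N$ matrices, $\mathbb{I}_N$ is the $N\times N$ identity matrix, $\|\cdot\|$ is the Euclidean norm, and $M^{1/2}$ denotes the unique positive semidefinite square root of a symmetric positive semidefinite matrix $M$ (with $M^{-1/2} = (M^{1/2})^{-1}$ when $M$ is positive definite). Interpretation: $\mathcal{L}_{GWB}(m,C)$ equals $\mathcal{W}_2^2\big(\mathcal{N}(m,C), \mathcal{N}(\mu_P, C_P)\big) + \lambda\, \mathcal{W}_2^2\big(\mathscr{P}_{\sharp}\mathcal{N}(m,C), \mathcal{N}(\nu_V, C_V)\big)$, where $\mathcal{W}_2$ is the $L_2$-Wasserstein distance between probability measures, $\mathcal{N}(m,C)$ is the Gaussian measure with mean $m$ and covariance $C$, and $\mathscr{P}_{\sharp}\mathcal{N}(m,C) = \mathcal{N}(\mathscr{P}m, \mathscr{P}C\mathscr{P}^T)$ (possibly degenerate) is the push-forward under the linear map $\mathscr{P}$. The claim is to be read with the explicit formula for $\mathcal{L}_{GWB}$ given there. *)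

theory Defs
  imports "HOL-Analysis.Analysis"
begin

definition psd :: "real^'n^'n \<Rightarrow> bool" where
  "psd M \<longleftrightarrow> transpose M = M \<and> (\<forall>x. 0 \<le> x \<bullet> (M *v x))"

definition Sym_pp :: "(real^'n^'n) set" where
  "Sym_pp = {M. transpose M = M \<and> (\<forall>x. x \<noteq> 0 \<longrightarrow> 0 < x \<bullet> (M *v x))}"

text \<open>The unique positive semidefinite square root; meaningful only for positive
  semidefinite arguments.\<close>

definition msqrt :: "real^'n^'n \<Rightarrow> real^'n^'n" where
  "msqrt M = (THE R. psd R \<and> R ** R = M)"

definition L_GWB ::
  "real^'na \<Rightarrow> real^'na^'na \<Rightarrow> real^'nv \<Rightarrow> real^'nv^'nv \<Rightarrow> real^'na^'nv \<Rightarrow> real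
    \<Rightarrow> real^'na \<Rightarrow> real^'na^'na \<Rightarrow> real" where
  "L_GWB \<mu>\<^sub>P C\<^sub>P \<nu>\<^sub>V C\<^sub>V P lam m C =
     (norm (m - \<mu>\<^sub>P))\<^sup>2
     + trace (C\<^sub>P + C - 2 *\<^sub>R msqrt (msqrt C\<^sub>P ** C ** msqrt C\<^sub>P))
     + lam * ((norm (P *v m - \<nu>\<^sub>V))\<^sup>2
        + trace (C\<^sub>V + P ** C ** transpose P
            - 2 *\<^sub>R msqrt (msqrt C\<^sub>V ** P ** C ** transpose P ** msqrt C\<^sub>V)))"

end

theory Submission
  imports Defs
begin

text \<open>
  The functional splits into a quadratic in \<open>m\<close>, minimized by its normal equation, and a part in \<open>C\<close>.
  For the latter, every positive semidefinite \<open>K\<close> with \<open>transpose H ** H = K ** D ** K\<close> yields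
  the supporting affine bound
  \<open>2 tr (H C H\<^sup>T)\<^sup>1\<^sup>/\<^sup>2 \<le> tr (K C) + tr (K D)\<close>, with equality at \<open>C = D\<close>.
  Put \<open>T = W + B\<close>, so that \<open>C\<^sub>\<star> = T C\<^sub>P T\<close>.  The bound applies to the first square root with
  \<open>K = T\<^sup>-\<^sup>1\<close>, and to the second with \<open>K = L W T\<^sup>-\<^sup>1\<close>, where \<open>B = \<lambda> W L W\<close>.
  The two slopes satisfy \<open>T\<^sup>-\<^sup>1 + \<lambda> K = 1 + \<lambda> P\<^sup>T P\<close>, so the resulting lower bound of the functional
  does not depend on \<open>C\<close> and is attained at \<open>C\<^sub>\<star>\<close>.
\<close>

section \<open>Positive semidefinite matrices and their square roots\<close>

text \<open>A maximizer \<open>v\<close> of \<open>x \<bullet> f x\<close> on the unit sphere of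
  \<open>S\<close> is an eigenvector: the residual \<open>w = f v - c *\<^sub>R v\<close> is
  orthogonal to \<open>v\<close>, and if it were nonzero, a small move from \<open>v\<close> along
  \<open>w\<close> would raise the Rayleigh quotient.\<close>

lemma self_adjoint_eigenvector:
  fixes f :: "'a::euclidean_space \<Rightarrow> 'a"
  assumes f: "linear f" and sa: "\<And>x y. x \<bullet> f y = f x \<bullet> y"
    and S: "subspace S" "S \<noteq> {0}" and inv: "\<And>x. x \<in> S \<Longrightarrow> f x \<in> S"
  obtains v c where "v \<in> S" "norm v = 1" "f v = c *\<^sub>R v"
proof -
  let ?K = "S \<inter> sphere 0 1"
  obtain x where x: "x \<in> S" "x \<noteq> 0" using S subspace_0 by blast
  then have "x /\<^sub>R norm x \<in> ?K" using S by (auto simp: subspace_scale)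
  then have ne: "?K \<noteq> {}" by blast
  have co: "compact ?K"
    using S(1) by (intro closed_Int_compact closed_subspace compact_sphere)
  have "continuous_on ?K (\<lambda>x. x \<bullet> f x)"
    by (intro continuous_intros linear_continuous_on linear_conv_bounded_linear[THEN iffD1] f)
  then obtain v where v: "v \<in> ?K" and mx: "\<And>y. y \<in> ?K \<Longrightarrow> y \<bullet> f y \<le> v \<bullet> f v"
    using continuous_attains_sup[OF co ne] by blast
  define c where "c = v \<bullet> f v"
  define w where "w = f v - c *\<^sub>R v"
  have vS: "v \<in> S" and vv: "v \<bullet> v = 1" using v by (auto simp: dot_square_norm)
  have wS: "w \<in> S" unfolding w_def using S vS inv by (simp add: subspace_diff subspace_scale)
  have wv: "v \<bullet> w = 0" by (simp add: w_def inner_diff_right vv c_def)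
  have wf: "w \<bullet> f v = w \<bullet> w"
    using wv by (simp add: w_def inner_diff_right inner_diff_left inner_commute)
  have bound: "y \<bullet> f y \<le> c * (y \<bullet> y)" if "y \<in> S" for y
  proof (cases "y = 0")
    case False
    have "(y /\<^sub>R norm y) \<bullet> f (y /\<^sub>R norm y) \<le> c"
      unfolding c_def using mx[of "y /\<^sub>R norm y"] False that S by (simp add: subspace_scale)
    then have "(y \<bullet> f y) / (norm y)\<^sup>2 \<le> c"
      by (simp add: linear_cmul[OF f] power2_eq_square divide_simps)
    then show ?thesis using False by (simp add: dot_square_norm divide_simps)
  qed (simp add: linear_0[OF f])
  have key: "2 * t * (w \<bullet> w) \<le> t\<^sup>2 * (c * (w \<bullet> w) - w \<bullet> f w)" for t
  proof -
    have "v + t *\<^sub>R w \<in> S" using S vS wS by (simp add: subspace_add subspace_scale)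
    from bound[OF this] show ?thesis
      using wv wf sa[of v w]
      by (simp add: linear_add[OF f] linear_cmul[OF f] inner_add_left inner_add_right vv c_def[symmetric]
          inner_commute power2_eq_square algebra_simps)
  qed
  have "w \<bullet> w = 0"
  proof (rule ccontr)
    assume "w \<bullet> w \<noteq> 0"
    then have p: "w \<bullet> w > 0" by simp
    \<comment> \<open>A positive bound on the quadratic coefficient in \<open>key\<close>. At
      \<open>t = w \<bullet> w / d\<close> the linear term is then twice the bound on the quadratic
      one.\<close>
    define d where "d = \<bar>c * (w \<bullet> w) - w \<bullet> f w\<bar> + 1"
    have d: "d > 0" "c * (w \<bullet> w) - w \<bullet> f w \<le> d" by (auto simp: d_def)
    have "2 * (w \<bullet> w / d) * (w \<bullet> w) \<le> (w \<bullet> w / d)\<^sup>2 * d"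
      using key[of "w \<bullet> w / d"] mult_left_mono[OF d(2), of "(w \<bullet> w / d)\<^sup>2"] by simp
    then have "2 * (w \<bullet> w)\<^sup>2 / d \<le> (w \<bullet> w)\<^sup>2 / d"
      using d(1) by (simp add: power2_eq_square)
    moreover have "0 < (w \<bullet> w)\<^sup>2 / d" using p d(1) by simp
    ultimately show False by simp
  qed
  then have "f v = c *\<^sub>R v" by (simp add: w_def)
  then show thesis using that v by auto
qed

text \<open>Induction on \<open>dim S\<close>: by self-adjointness, the orthogonal complement in
  \<open>S\<close> of a unit eigenvector is again invariant.\<close>

lemma self_adjoint_eigenbasis:
  fixes f :: "'a::euclidean_space \<Rightarrow> 'a"
  assumes f: "linear f" and sa: "\<And>x y. x \<bullet> f y = f x \<bullet> y"
    and "subspace S" and "\<And>x. x \<in> S \<Longrightarrow> f x \<in> S"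
  shows "\<exists>B. finite B \<and> B \<subseteq> S \<and> pairwise orthogonal B \<and> (\<forall>b\<in>B. norm b = 1)
    \<and> S \<subseteq> span B \<and> (\<forall>b\<in>B. \<exists>c. f b = c *\<^sub>R b)"
  using assms(3,4)
proof (induction "dim S" arbitrary: S rule: less_induct)
  case less
  show ?case
  proof (cases "S = {0}")
    case True
    then show ?thesis by (intro exI[of _ "{}"]) auto
  next
    case False
    then obtain v c where v: "v \<in> S" "norm v = 1" "f v = c *\<^sub>R v"
      using self_adjoint_eigenvector[OF f sa less.prems(1)] less.prems(2) by metis
    define S' where "S' = {x \<in> S. v \<bullet> x = 0}"
    have S': "subspace S'"
      using less.prems(1) unfolding S'_def subspace_def by (auto simp: inner_add_right)
    have inv: "f x \<in> S'" if "x \<in> S'" for x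
      using that less.prems(2) v(3) sa[of v x] by (auto simp: S'_def)
    have "v \<notin> S'" using v by (simp add: S'_def dot_square_norm)
    then have "S' \<subset> S" using v(1) unfolding S'_def by blast
    then have "dim S' < dim S"
      using S' less.prems(1) by (intro dim_psubset) (metis span_eq_iff)
    from less.hyps[OF this S' inv] obtain B where B: "finite B" "B \<subseteq> S'" "pairwise orthogonal B"
      "\<forall>b\<in>B. norm b = 1" "S' \<subseteq> span B" "\<forall>b\<in>B. \<exists>c. f b = c *\<^sub>R b" by blast
    have "x \<in> span (insert v B)" if "x \<in> S" for x
    proof -
      have "x - (v \<bullet> x) *\<^sub>R v \<in> S'"
        using that v less.prems(1)
        by (simp add: S'_def subspace_diff subspace_scale inner_diff_right dot_square_norm)
      then show ?thesis using B(5) span_breakdown_eq[of x v B] by blast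
    qed
    moreover have "pairwise orthogonal (insert v B)"
      using B(2,3) by (auto simp: pairwise_insert S'_def orthogonal_def inner_commute)
    ultimately show ?thesis using B v
      by (intro exI[of _ "insert v B"]) (auto simp: S'_def)
  qed
qed

section \<open>Existence of the square root\<close>

lemma inner_mult_left_transpose: "(A *v x) \<bullet> y = x \<bullet> (transpose A *v y)"
  for A :: "real^'n^'m"
  by (metis dot_lmul_matrix inner_commute transpose_matrix_vector)

lemma psd_sym: "psd M \<Longrightarrow> transpose M = M"
  by (simp add: psd_def)

lemma psd_nonneg: "psd M \<Longrightarrow> 0 \<le> x \<bullet> (M *v x)"
  by (simp add: psd_def)

text \<open>In an orthonormal eigenbasis of \<open>M\<close>, the map \<open>g\<close> multiplies
  each coordinate by the square root of its eigenvalue.\<close>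

lemma psd_square_root_exists:
  assumes "psd M" shows "\<exists>R. psd R \<and> R ** R = M"
proof -
  let ?f = "(*v) M"
  have sa: "x \<bullet> ?f y = ?f x \<bullet> y" for x y
    using assms inner_mult_left_transpose[of M x y] by (simp add: psd_def)
  obtain B where B: "finite B" "pairwise orthogonal B" "\<forall>b\<in>B. norm b = 1"
      "span B = UNIV" "\<forall>b\<in>B. \<exists>c. M *v b = c *\<^sub>R b"
    using self_adjoint_eigenbasis[of ?f UNIV] sa by auto
  then obtain c where c: "\<And>b. b \<in> B \<Longrightarrow> M *v b = c b *\<^sub>R b" by metis
  have c0: "0 \<le> c b" if "b \<in> B" for b
    using psd_nonneg[OF assms, of b] c[OF that] B(3) that by (simp add: dot_square_norm)
  define g where "g x = (\<Sum>b\<in>B. (sqrt (c b) * (b \<bullet> x)) *\<^sub>R b)" for x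
  have lg: "linear g"
    by (rule linearI) (auto simp: g_def inner_add_right algebra_simps sum.distrib scaleR_sum_right)
  define R where "R = matrix g"
  have R: "R *v x = g x" for x unfolding R_def by (simp add: matrix_works lg)
  have sym: "x \<bullet> g y = g x \<bullet> y" for x y
    by (simp add: g_def inner_sum_left inner_sum_right inner_commute mult.assoc)
      (simp add: mult.left_commute mult.commute)
  have gb: "g b = sqrt (c b) *\<^sub>R b" if "b \<in> B" for b
  proof -
    have "g b = (\<Sum>b'\<in>B. if b' = b then sqrt (c b) *\<^sub>R b else 0)"
      unfolding g_def using B(2,3) that
      by (intro sum.cong) (auto simp: dot_square_norm pairwise_def orthogonal_def)
    then show ?thesis using B(1) that by simp
  qed
  have "transpose R = R"
    by (rule matrix_eq[THEN iffD2])
      (metis R inner_mult_left_transpose sym vector_eq_rdot inner_commute)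
  moreover have "0 \<le> x \<bullet> (R *v x)" for x
    unfolding R g_def inner_sum_right
    by (intro sum_nonneg) (auto simp: c0 inner_commute mult.assoc)
  ultimately have "psd R" by (simp add: psd_def)
  moreover have "R ** R = M"
  proof -
    have "g (g x) = M *v x" for x
    proof -
      have "linear (\<lambda>x. g (g x))" using linear_compose[OF lg lg] by (simp add: o_def)
      moreover have "g (g b) = M *v b" if "b \<in> B" for b
        using that by (simp add: gb linear_cmul[OF lg] c c0)
      ultimately show ?thesis
        using linear_eq_on_span[of "\<lambda>x. g (g x)" "(*v) M" B x] B(4) by simp
    qed
    then show ?thesis
      by (intro matrix_eq[THEN iffD2]) (simp add: R matrix_vector_mul_assoc[symmetric])
  qed
  ultimately show ?thesis by blast
qed


section \<open>Matrix algebra, congruence and positive definiteness\<close>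

lemma matrix_add_rdistrib: "(A + B) ** C = A ** C + B ** C"
  for A B :: "real^'n^'m"
  by (simp add: matrix_matrix_mult_def vec_eq_iff algebra_simps sum.distrib)

lemma matrix_diff_ldistrib: "A ** (B - C) = A ** B - A ** C"
  for A :: "real^'n^'m"
  by (simp add: matrix_matrix_mult_def vec_eq_iff algebra_simps sum_subtractf)

lemma matrix_diff_rdistrib: "(A - B) ** C = A ** C - B ** C"
  for A B :: "real^'n^'m"
  by (simp add: matrix_matrix_mult_def vec_eq_iff algebra_simps sum_subtractf)

lemma transpose_add: "transpose (A + B) = transpose A + transpose B"
  by (simp add: transpose_def vec_eq_iff)

lemma transpose_diff: "transpose (A - B) = transpose A - transpose B"
  by (simp add: transpose_def vec_eq_iff)

lemma trace_scaleR: "trace (r *\<^sub>R A) = r * trace A" for A :: "real^'n^'n"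
  by (simp add: trace_def sum_distrib_left)

lemma invertible_inv:
  assumes "invertible M"
  shows "M ** matrix_inv M = mat 1" and "matrix_inv M ** M = mat 1"
  using someI_ex[OF assms[unfolded invertible_def]] by (simp_all add: matrix_inv_def)

lemma psd_congruence:
  assumes "psd E" shows "psd (transpose X ** E ** X)"
proof -
  have "x \<bullet> ((transpose X ** E ** X) *v x) = (X *v x) \<bullet> (E *v (X *v x))" for x
    by (simp add: inner_mult_left_transpose matrix_vector_mul_assoc matrix_mul_assoc
        del: transpose_matrix_vector)
  then show ?thesis
    using assms by (simp add: psd_def matrix_transpose_mul matrix_mul_assoc)
qed

lemma psd_mat_1: "psd (mat 1)"
  by (simp add: psd_def)

lemma psd_add: "psd A \<Longrightarrow> psd B \<Longrightarrow> psd (A + B)"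
  by (simp add: psd_def transpose_add matrix_vector_mult_add_rdistrib inner_add_right)

lemma psd_scaleR: "psd A \<Longrightarrow> 0 \<le> r \<Longrightarrow> psd (r *\<^sub>R A)"
  by (simp add: psd_def transpose_scalar scaleR_matrix_vector_assoc[symmetric])

lemma psd_gram: "psd (transpose X ** X)"
  using psd_congruence[OF psd_mat_1, of X] by simp

text \<open>With a symmetric root \<open>R\<close> of \<open>M\<close>, the quadratic form is the
  squared norm of \<open>R *v x\<close>.\<close>

lemma psd_kernel:
  assumes "psd M" "x \<bullet> (M *v x) = 0" shows "M *v x = 0"
proof -
  obtain R where R: "psd R" "R ** R = M" using psd_square_root_exists[OF assms(1)] by blast
  have "(R *v x) \<bullet> (R *v x) = x \<bullet> (M *v x)"
    using psd_sym[OF R(1)] R(2) by (simp add: inner_mult_left_transpose matrix_vector_mul_assoc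
        del: transpose_matrix_vector)
  then have "R *v x = 0" using assms(2) by simp
  then show ?thesis using R(2) by (metis matrix_vector_mul_assoc matrix_vector_mult_0_right)
qed

lemma Sym_pp_iff: "M \<in> Sym_pp \<longleftrightarrow> psd M \<and> invertible M"
proof
  assume M: "M \<in> Sym_pp"
  then have pos: "x \<noteq> 0 \<Longrightarrow> 0 < x \<bullet> (M *v x)" for x by (simp add: Sym_pp_def)
  have "0 \<le> x \<bullet> (M *v x)" for x using pos[of x] by (cases "x = 0") auto
  then have "psd M" using M by (simp add: Sym_pp_def psd_def)
  moreover have "x = 0" if "M *v x = 0" for x
    using pos[of x] that by (cases "x = 0") auto
  then have "\<exists>B. B ** M = mat 1" unfolding matrix_left_invertible_ker by blast
  then have "invertible M" by (simp add: invertible_left_inverse)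
  ultimately show "psd M \<and> invertible M" by simp
next
  assume M: "psd M \<and> invertible M"
  have "x = 0" if "M *v x = 0" for x
  proof -
    have "x = matrix_inv M *v (M *v x)"
      using M by (simp add: matrix_vector_mul_assoc invertible_inv)
    then show ?thesis using that by simp
  qed
  then have "0 < x \<bullet> (M *v x)" if "x \<noteq> 0" for x
    using M psd_nonneg[of M x] psd_kernel[of M x] that by fastforce
  then show "M \<in> Sym_pp"
    using M by (simp add: Sym_pp_def psd_sym)
qed

lemma Sym_pp_add:
  assumes "M \<in> Sym_pp" "psd E" shows "M + E \<in> Sym_pp"
  using assms unfolding Sym_pp_def psd_def
  by (simp add: transpose_add matrix_vector_mult_add_rdistrib inner_add_right add_pos_nonneg)

lemma psd_add_pos_identity:
  assumes "psd E" "0 < e" shows "E + e *\<^sub>R mat 1 \<in> Sym_pp"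
  using assms unfolding Sym_pp_def psd_def
  by (simp add: transpose_add transpose_scalar matrix_vector_mult_add_rdistrib inner_add_right
      scaleR_matrix_vector_assoc[symmetric] add_nonneg_pos)

text \<open>The inverse is the congruence of \<open>M\<close> by \<open>matrix_inv M\<close>
  itself.\<close>

lemma Sym_pp_inv:
  assumes "M \<in> Sym_pp" shows "matrix_inv M \<in> Sym_pp"
proof -
  have M: "psd M" "invertible M" using assms by (auto simp: Sym_pp_iff)
  note i = invertible_inv[OF M(2)]
  have "transpose (matrix_inv M) ** M = mat 1"
    using i(1) psd_sym[OF M(1)] by (metis matrix_transpose_mul transpose_mat)
  then have "psd (matrix_inv M)"
    using psd_congruence[OF M(1), of "matrix_inv M"] by simp
  moreover have "invertible (matrix_inv M)" using i unfolding invertible_def by blast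
  ultimately show ?thesis by (simp add: Sym_pp_iff)
qed

lemma Sym_pp_congruence:
  assumes "M \<in> Sym_pp" "X \<in> Sym_pp" shows "X ** M ** X \<in> Sym_pp"
  using assms psd_congruence[of M X] by (simp add: Sym_pp_iff psd_sym invertible_mult)

section \<open>Trace inequalities and uniqueness of the square root\<close>

lemma trace_psd_nonneg:
  assumes "psd E" shows "0 \<le> trace E"
proof -
  have "E $ i $ i = axis i 1 \<bullet> (E *v axis i 1)" for i
    by (simp add: inner_axis' matrix_vector_mult_basis column_def)
  then show ?thesis using assms by (simp add: trace_def psd_def sum_nonneg)
qed

text \<open>The product \<open>E ** C\<close> may fail to be symmetric, but by cyclicity its trace
  is that of the congruence of \<open>E\<close> by a root of \<open>C\<close>.\<close>

lemma trace_psd_mult_nonneg: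
  assumes "psd E" "psd C" shows "0 \<le> trace (E ** C)"
proof -
  obtain S where S: "psd S" "S ** S = C" using psd_square_root_exists[OF assms(2)] by blast
  have "trace (E ** C) = trace (transpose S ** E ** S)"
    using S by (metis matrix_mul_assoc psd_sym trace_mul_sym)
  then show ?thesis using psd_congruence[OF assms(1)] trace_psd_nonneg by metis
qed

lemma trace_gram_eq_0D:
  fixes X :: "real^'n^'m"
  assumes "trace (transpose X ** X) = 0" shows "X = 0"
proof -
  have "trace (transpose X ** X) = (\<Sum>j\<in>UNIV. \<Sum>i\<in>UNIV. (X $ i $ j)\<^sup>2)"
    by (simp add: trace_def matrix_matrix_mult_def transpose_def power2_eq_square)
  then show ?thesis
    using assms by (simp add: sum_nonneg_eq_0_iff sum_nonneg vec_eq_iff)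
qed

text \<open>For \<open>Y = R - R'\<close>, equal squares give \<open>R ** Y + Y ** R' = 0\<close>.
  Multiplying by \<open>Y\<close> and taking traces leaves two nonnegative terms with sum zero;
  hence \<open>R ** Y\<close> and \<open>R' ** Y\<close> vanish, and so does
  \<open>Y ** Y\<close>.\<close>

lemma psd_square_root_unique:
  assumes "psd R" "psd R'" "R ** R = R' ** R'" shows "R = R'"
proof -
  define Y where "Y = R - R'"
  have sY: "transpose Y = Y" using assms by (simp add: Y_def transpose_diff psd_sym)
  have "R ** Y + Y ** R' = 0"
    using assms(3) by (simp add: Y_def matrix_diff_ldistrib matrix_diff_rdistrib)
  then have "Y ** R ** Y + (transpose Y ** Y) ** R' = 0"
    using matrix_add_ldistrib[of Y "R ** Y" "Y ** R'"] sY by (simp add: matrix_mul_assoc)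
  then have "trace (Y ** R ** Y) + trace ((transpose Y ** Y) ** R') = 0"
    by (metis trace_add trace_0 mat_0)
  moreover have "psd (Y ** R ** Y)" using psd_congruence[OF assms(1), of Y] sY by simp
  ultimately have z: "trace (Y ** Y ** R') = 0" "trace (Y ** R ** Y) = 0"
    using trace_psd_nonneg[of "Y ** R ** Y"] trace_psd_mult_nonneg[OF psd_gram assms(2), of Y] sY
    by auto
  \<comment> \<open>The trace is the squared Frobenius norm of \<open>S ** Y\<close> for a root
    \<open>S\<close> of \<open>M\<close>.\<close>
  have ker: "M ** Y = 0" if M: "psd M" "trace (Y ** M ** Y) = 0" for M
  proof -
    obtain S where S: "psd S" "S ** S = M" using psd_square_root_exists[OF M(1)] by blast
    have "transpose (S ** Y) ** (S ** Y) = Y ** M ** Y"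
      unfolding S(2)[symmetric] using sY psd_sym[OF S(1)]
      by (simp add: matrix_transpose_mul matrix_mul_assoc)
    then have "S ** Y = 0" using M(2) trace_gram_eq_0D by metis
    then show ?thesis using S(2) by (metis matrix_mul_assoc times0_right)
  qed
  have "R ** Y = 0" using ker[OF assms(1)] z(2) by simp
  moreover have "R' ** Y = 0"
    using ker[OF assms(2)] z(1) trace_mul_sym[of Y "Y ** R'"] trace_mul_sym[of "Y ** R'" Y]
    by (simp add: matrix_mul_assoc)
  ultimately have "transpose Y ** Y = 0"
    using matrix_diff_rdistrib[of R R' Y] sY by (simp flip: Y_def)
  then have "Y = 0" using trace_gram_eq_0D[of Y] by (simp add: trace_def)
  then show ?thesis by (simp add: Y_def)
qed

lemma msqrt_eqI: "psd R \<Longrightarrow> R ** R = M \<Longrightarrow> msqrt M = R"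
  unfolding msqrt_def by (blast intro: the_equality psd_square_root_unique)

lemma msqrt:
  assumes "psd M" shows "psd (msqrt M)" and "msqrt M ** msqrt M = M"
proof -
  obtain R where "psd R" "R ** R = M" using psd_square_root_exists[OF assms] by blast
  then show "psd (msqrt M)" "msqrt M ** msqrt M = M" using msqrt_eqI by metis+
qed

lemma msqrt_Sym_pp:
  assumes "M \<in> Sym_pp" shows "msqrt M \<in> Sym_pp"
proof -
  have M: "psd M" "invertible M" using assms by (auto simp: Sym_pp_iff)
  have "msqrt M ** (msqrt M ** matrix_inv M) = mat 1"
    using msqrt(2)[OF M(1)] invertible_inv[OF M(2)] by (simp add: matrix_mul_assoc)
  then show ?thesis using msqrt(1)[OF M(1)] by (auto simp: Sym_pp_iff invertible_right_inverse)
qed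

section \<open>Supporting affine bounds for the trace of a square root\<close>

text \<open>Removes the regularizations by \<open>e *\<^sub>R mat 1\<close> from the bounds
  below.\<close>

lemma le_if_le_add_eps_mult:
  fixes a b c :: real
  assumes "\<And>e. 0 < e \<Longrightarrow> a \<le> b + e * c" shows "a \<le> b"
proof (rule field_le_epsilon)
  fix e :: real assume e: "0 < e"
  have "e / (\<bar>c\<bar> + 1) * c \<le> e / (\<bar>c\<bar> + 1) * (\<bar>c\<bar> + 1)"
    using e by (intro mult_left_mono) auto
  also have "\<dots> = e" by simp
  finally show "a \<le> b + e"
    using assms[of "e / (\<bar>c\<bar> + 1)"] e by (simp add: add_pos_nonneg)
qed

text \<open>This expands the nonnegative trace of
  \<open>(M - R) ** matrix_inv M ** (M - R)\<close>.\<close>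

lemma trace_le_am_gm:
  assumes M: "M \<in> Sym_pp" and R: "psd R"
  shows "2 * trace R \<le> trace M + trace (matrix_inv M ** (R ** R))"
proof -
  let ?N = "matrix_inv M"
  have i: "M ** ?N = mat 1" "?N ** M = mat 1" using M by (auto simp: Sym_pp_iff invertible_inv)
  have "transpose (M - R) = M - R" using M R by (simp add: transpose_diff psd_sym Sym_pp_iff)
  then have "psd ((M - R) ** ?N ** (M - R))"
    using Sym_pp_inv[OF M] psd_congruence[of ?N "M - R"] by (simp add: Sym_pp_iff)
  then have "0 \<le> trace ((M - R) ** ?N ** (M - R))" by (rule trace_psd_nonneg)
  moreover have "(M - R) ** ?N ** (M - R) = (M + R ** ?N ** R) - (R + R)"
    using i by (simp add: matrix_diff_ldistrib matrix_diff_rdistrib matrix_mul_assoc[symmetric] algebra_simps)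
  moreover have "trace (R ** ?N ** R) = trace (?N ** (R ** R))"
    using trace_mul_sym[of R "?N ** R"] by (simp add: matrix_mul_assoc)
  ultimately show ?thesis by (simp only: trace_add trace_sub)
qed

text \<open>The hypothesis \<open>block\<close> is positivity of the block matrix with diagonal
  \<open>G\<close>, \<open>M\<close> and off-diagonal \<open>-H\<close>. The choice
  \<open>y = M^-1 H x\<close> minimizes its form in \<open>y\<close> and leaves the Schur
  complement.\<close>

lemma schur_complement_psd:
  fixes H :: "real^'n^'m"
  assumes M: "M \<in> Sym_pp" and G: "psd G"
    and block: "\<And>x y. 2 * (y \<bullet> (H *v x)) \<le> x \<bullet> (G *v x) + y \<bullet> (M *v y)"
  shows "psd (G - transpose H ** matrix_inv M ** H)"
proof -
  let ?N = "matrix_inv M"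
  have N: "psd ?N" "M ** ?N = mat 1"
    using M Sym_pp_inv[OF M] by (auto simp: Sym_pp_iff invertible_inv)
  have "x \<bullet> ((transpose H ** ?N ** H) *v x) \<le> x \<bullet> (G *v x)" for x
  proof -
    have "x \<bullet> ((transpose H ** ?N ** H) *v x) = (?N *v (H *v x)) \<bullet> (H *v x)"
      using inner_mult_left_transpose[of H x "?N *v (H *v x)"]
      by (simp add: matrix_vector_mul_assoc matrix_mul_assoc inner_commute del: transpose_matrix_vector)
    moreover have "M *v (?N *v (H *v x)) = H *v x"
      using N(2) by (simp add: matrix_vector_mul_assoc matrix_mul_assoc)
    ultimately show ?thesis using block[of "?N *v (H *v x)" x] by simp
  qed
  then show ?thesis
    using psd_sym[OF G] psd_sym[OF psd_congruence[OF N(1), of H]]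
    by (simp add: psd_def transpose_diff matrix_vector_mult_diff_rdistrib inner_diff_right)
qed

text \<open>The bound is weighted AM-GM with \<open>M = H G\<^sup>-\<^sup>1 H\<^sup>T + e\<close>: this \<open>M\<close> makes the block matrix of \<open>G\<close>, \<open>H\<close>, \<open>M\<close>
  positive semidefinite, hence \<open>H\<^sup>T M\<^sup>-\<^sup>1 H \<le> G\<close>; the shift by \<open>e\<close> handles a singular \<open>H\<close>.\<close>

lemma trace_sqrt_le_Sym_pp:
  fixes H :: "real^'n^'m"
  assumes G: "G \<in> Sym_pp" and C: "psd C" and R: "psd R" "R ** R = H ** C ** transpose H"
  shows "2 * trace R \<le> trace (G ** C) + trace (matrix_inv G ** (transpose H ** H))"
proof (rule le_if_le_add_eps_mult)
  fix e :: real assume e: "0 < e"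
  let ?I = "matrix_inv G"
  have I: "psd ?I" "G ** ?I = mat 1" "?I ** G = mat 1" "psd G"
    using G Sym_pp_inv[OF G] by (auto simp: Sym_pp_iff invertible_inv)
  define M where "M = H ** ?I ** transpose H + e *\<^sub>R mat 1"
  have pH: "psd (H ** ?I ** transpose H)" using psd_congruence[OF I(1), of "transpose H"] by simp
  then have M: "M \<in> Sym_pp" unfolding M_def by (intro psd_add_pos_identity e)
  have "psd (G - transpose H ** matrix_inv M ** H)"
  proof (rule schur_complement_psd[OF M I(4)])
    fix x y
    let ?h = "transpose H *v y"
    \<comment> \<open>Completed square: it expands to \<open>x \<bullet> G x - 2 (y \<bullet> H x) +
      y \<bullet> (H G^-1 H^T) y\<close>.\<close>
    have "0 \<le> (G *v x - ?h) \<bullet> (?I *v (G *v x - ?h))" by (rule psd_nonneg[OF I(1)])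
    also have "?I *v (G *v x - ?h) = x - ?I *v ?h"
      using I(3) by (simp add: matrix_vector_mult_diff_distrib matrix_vector_mul_assoc del: transpose_matrix_vector)
    also have "(G *v x - ?h) \<bullet> (x - ?I *v ?h) =
        x \<bullet> (G *v x) - ?h \<bullet> x - (G *v x) \<bullet> (?I *v ?h) + ?h \<bullet> (?I *v ?h)"
      by (simp add: inner_diff_left inner_diff_right inner_commute del: transpose_matrix_vector)
    also have "(G *v x) \<bullet> (?I *v ?h) = ?h \<bullet> x"
      using I(2) psd_sym[OF I(4)]
      by (simp add: inner_mult_left_transpose matrix_vector_mul_assoc inner_commute
          matrix_mul_assoc del: transpose_matrix_vector)
    also have "?h \<bullet> x = y \<bullet> (H *v x)"
      using inner_mult_left_transpose[of H x y] by (simp add: inner_commute del: transpose_matrix_vector)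
    also have "?h \<bullet> (?I *v ?h) = y \<bullet> ((H ** ?I ** transpose H) *v y)"
      using inner_mult_left_transpose[of "transpose H" y "?I *v ?h"]
      by (simp add: matrix_vector_mul_assoc matrix_mul_assoc del: transpose_matrix_vector)
    also have "\<dots> \<le> y \<bullet> (M *v y)"
      using e by (simp add: M_def matrix_vector_mult_add_rdistrib inner_add_right
          scaleR_matrix_vector_assoc[symmetric])
    finally show "2 * (y \<bullet> (H *v x)) \<le> x \<bullet> (G *v x) + y \<bullet> (M *v y)" by linarith
  qed
  from trace_psd_mult_nonneg[OF this C]
  have "trace (transpose H ** matrix_inv M ** H ** C) \<le> trace (G ** C)"
    by (simp add: matrix_diff_rdistrib trace_sub)
  moreover have "trace (matrix_inv M ** (R ** R)) = trace (transpose H ** matrix_inv M ** H ** C)"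
    using trace_mul_sym[of "matrix_inv M ** H ** C" "transpose H"] R(2)
    by (simp add: matrix_mul_assoc)
  moreover have "trace M = trace (?I ** (transpose H ** H)) + e * real CARD('m)"
    using trace_mul_sym[of H "?I ** transpose H"]
    by (simp add: M_def trace_add trace_scaleR trace_I matrix_mul_assoc)
  ultimately show "2 * trace R \<le> trace (G ** C) + trace (?I ** (transpose H ** H)) + e * real CARD('m)"
    using trace_le_am_gm[OF M R(1)] by simp
qed

text \<open>Extends the preceding bound to a singular slope \<open>K\<close>, which occurs when
  \<open>P\<close> is not injective. It is applied to \<open>G = K + e\<close>; since
  \<open>K G^-1 K \<le> K\<close>, the constant term is at most
  \<open>trace (K ** D)\<close>.\<close>

lemma trace_sqrt_le:
  fixes H :: "real^'n^'m"
  assumes C: "psd C" and R: "psd R" "R ** R = H ** C ** transpose H"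
    and K: "psd K" and D: "psd D" and HK: "transpose H ** H = K ** D ** K"
  shows "2 * trace R \<le> trace (K ** C) + trace (K ** D)"
proof (rule le_if_le_add_eps_mult)
  fix e :: real assume e: "0 < e"
  define G where "G = K + e *\<^sub>R mat 1"
  have G: "G \<in> Sym_pp" unfolding G_def by (rule psd_add_pos_identity[OF K e])
  have "psd (K - transpose K ** matrix_inv G ** K)"
  proof (rule schur_complement_psd[OF G K])
    fix x y
    have "0 \<le> (x - y) \<bullet> (K *v (x - y))" by (rule psd_nonneg[OF K])
    moreover have "x \<bullet> (K *v y) = y \<bullet> (K *v x)"
      using inner_mult_left_transpose[of K x y] psd_sym[OF K] by (simp add: inner_commute)
    moreover have "y \<bullet> (K *v y) \<le> y \<bullet> (G *v y)"
      using e by (simp add: G_def matrix_vector_mult_add_rdistrib inner_add_right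
          scaleR_matrix_vector_assoc[symmetric])
    ultimately show "2 * (y \<bullet> (K *v x)) \<le> x \<bullet> (K *v x) + y \<bullet> (G *v y)"
      by (simp add: matrix_vector_mult_diff_distrib inner_diff_left inner_diff_right)
  qed
  from trace_psd_mult_nonneg[OF this D]
  have "trace (K ** matrix_inv G ** K ** D) \<le> trace (K ** D)"
    by (simp add: matrix_diff_rdistrib trace_sub psd_sym[OF K])
  moreover have "trace (matrix_inv G ** (K ** D ** K)) = trace (K ** matrix_inv G ** K ** D)"
    using trace_mul_sym[of "matrix_inv G ** K ** D" K] by (simp add: matrix_mul_assoc)
  moreover have "trace (G ** C) = trace (K ** C) + e * trace C"
    by (simp add: G_def matrix_add_rdistrib trace_add trace_scaleR flip: scalar_matrix_assoc)
  ultimately show "2 * trace R \<le> trace (K ** C) + trace (K ** D) + e * trace C"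
    using trace_sqrt_le_Sym_pp[OF G C R] HK by simp
qed

lemma trace_msqrt_le:
  fixes H :: "real^'n^'m"
  assumes "psd C" "psd K" "psd D" "transpose H ** H = K ** D ** K"
  shows "2 * trace (msqrt (H ** C ** transpose H)) \<le> trace (K ** C) + trace (K ** D)"
proof -
  have "psd (H ** C ** transpose H)" using psd_congruence[OF assms(1), of "transpose H"] by simp
  from trace_sqrt_le[OF assms(1) msqrt[OF this] assms(2-4)] show ?thesis .
qed

text \<open>The upper bound is applied to the reversed pair: with \<open>S = D\<^sup>1\<^sup>/\<^sup>2\<close>, the matrix \<open>S K S\<close> is the
  square root of \<open>S H\<^sup>T H S\<close>, whose trace is at most that of the square root of \<open>H D H\<^sup>T\<close>.\<close>

lemma trace_msqrt_ge:
  fixes H :: "real^'n^'m"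
  assumes K: "psd K" and D: "psd D" and HK: "transpose H ** H = K ** D ** K"
  shows "trace (K ** D) \<le> trace (msqrt (H ** D ** transpose H))"
proof -
  define R where "R = msqrt (H ** D ** transpose H)"
  define S where "S = msqrt D"
  have R: "psd R" "R ** R = H ** D ** transpose H"
    using psd_congruence[OF D, of "transpose H"] by (auto simp: R_def msqrt)
  have S: "psd S" "S ** S = D" "transpose S = S"
    using msqrt[OF D] psd_sym by (auto simp: S_def)
  have N: "psd (S ** K ** S)" using psd_congruence[OF K, of S] S by simp
  have "(S ** K ** S) ** (S ** K ** S) = S ** (K ** D ** K) ** S"
    unfolding S(2)[symmetric] by (simp add: matrix_mul_assoc)
  also have "\<dots> = (S ** transpose H) ** mat 1 ** transpose (S ** transpose H)"
    using S by (simp add: HK[symmetric] matrix_transpose_mul matrix_mul_assoc)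
  finally have N2: "(S ** K ** S) ** (S ** K ** S) = \<dots>" .
  \<comment> \<open>The upper bound is used with factor \<open>S ** transpose H\<close>, slope
    \<open>R\<close>, and the identity in place of both \<open>C\<close> and \<open>D\<close>; both
    terms on its right are then \<open>trace R\<close>.\<close>
  have "transpose (S ** transpose H) ** (S ** transpose H) = R ** mat 1 ** R"
    using R S by (simp add: matrix_transpose_mul matrix_mul_assoc)
      (metis matrix_mul_assoc)
  from trace_sqrt_le[OF psd_mat_1 N N2 R(1) psd_mat_1 this]
  have "trace (S ** K ** S) \<le> trace R" by simp
  moreover have "trace (S ** K ** S) = trace (K ** D)"
    using trace_mul_sym[of S "K ** S"] S by (simp add: matrix_mul_assoc[symmetric])
  ultimately show ?thesis by (simp add: R_def)
qed

section \<open>The barycenter functional\<close>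

text \<open>The equation for \<open>s\<close> is the normal equation: expanding around
  \<open>s\<close>, the linear term in \<open>d = m - s\<close> vanishes and a nonnegative quadratic
  remains.\<close>

lemma quadratic_minimizer:
  fixes P :: "real^'n^'m"
  assumes lam: "0 \<le> lam" and s: "(mat 1 + lam *\<^sub>R (transpose P ** P)) *v s = a + lam *\<^sub>R (transpose P *v b)"
  shows "(norm (s - a))\<^sup>2 + lam * (norm (P *v s - b))\<^sup>2 \<le> (norm (m - a))\<^sup>2 + lam * (norm (P *v m - b))\<^sup>2"
proof -
  define d where "d = m - s"
  have P: "(P *v d) \<bullet> y = d \<bullet> (transpose P *v y)" for y
    by (rule inner_mult_left_transpose)
  have "s - a + lam *\<^sub>R (transpose P *v (P *v s - b)) = 0"
    using s by (simp add: matrix_vector_mult_add_rdistrib scaleR_matrix_vector_assoc[symmetric]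
        matrix_vector_mult_diff_distrib scaleR_diff_right matrix_vector_mul_assoc algebra_simps
        del: transpose_matrix_vector)
  then have "d \<bullet> (s - a + lam *\<^sub>R (transpose P *v (P *v s - b))) = 0" by simp
  then have stat: "d \<bullet> (s - a) + lam * ((P *v d) \<bullet> (P *v s - b)) = 0"
    unfolding P by (simp add: inner_add_right)
  have "m - a = d + (s - a)" "P *v m - b = P *v d + (P *v s - b)"
    by (simp_all add: d_def matrix_vector_mult_diff_distrib)
  then have "(norm (m - a))\<^sup>2 + lam * (norm (P *v m - b))\<^sup>2
      = (norm (s - a))\<^sup>2 + lam * (norm (P *v s - b))\<^sup>2
        + ((norm d)\<^sup>2 + lam * (norm (P *v d))\<^sup>2)
        + 2 * (d \<bullet> (s - a) + lam * ((P *v d) \<bullet> (P *v s - b)))"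
    by (simp only: power2_norm_eq_inner inner_add_left inner_add_right)
      (simp add: algebra_simps inner_commute)
  moreover have "0 \<le> (norm d)\<^sup>2 + lam * (norm (P *v d))\<^sup>2" using lam by simp
  ultimately show ?thesis using stat by simp
qed

text \<open>Isolates the optimality conditions from the closed form: \<open>matrix_inv T\<close> and
  \<open>K\<close> are slopes certifying that \<open>D\<close> is optimal, and \<open>W\<close> and
  \<open>B\<close> do not enter.\<close>

lemma covariance_minimizer:
  fixes P :: "real^'n^'m"
  assumes lam: "0 \<le> lam" and CP: "CP \<in> Sym_pp" and CV: "psd CV" and C: "psd C"
    and T: "T \<in> Sym_pp" and K: "psd K"
    and D: "D = T ** CP ** T"
    and KD: "K ** D ** K = transpose P ** CV ** P"
    and stat: "matrix_inv T + lam *\<^sub>R K = mat 1 + lam *\<^sub>R (transpose P ** P)"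
  shows "trace (CP + D - 2 *\<^sub>R msqrt (msqrt CP ** D ** msqrt CP))
      + lam * trace (CV + P ** D ** transpose P
          - 2 *\<^sub>R msqrt (msqrt CV ** P ** D ** transpose P ** msqrt CV))
    \<le> trace (CP + C - 2 *\<^sub>R msqrt (msqrt CP ** C ** msqrt CP))
      + lam * trace (CV + P ** C ** transpose P
          - 2 *\<^sub>R msqrt (msqrt CV ** P ** C ** transpose P ** msqrt CV))"
proof -
  let ?I = "matrix_inv T"
  have CP': "psd CP" using CP by (simp add: Sym_pp_iff)
  have I: "psd ?I" "T ** ?I = mat 1" "?I ** T = mat 1" "psd T"
    using T Sym_pp_inv[OF T] by (auto simp: Sym_pp_iff invertible_inv)
  have pD: "psd D" using psd_congruence[OF CP', of T] psd_sym[OF I(4)] D by simp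
  note Q = msqrt[OF CP'] psd_sym[OF msqrt(1)[OF CP']]
  note V = msqrt[OF CV] psd_sym[OF msqrt(1)[OF CV]]
  define F1 where "F1 X = trace (msqrt (msqrt CP ** X ** msqrt CP))" for X
  define F2 where "F2 X = trace (msqrt (msqrt CV ** P ** X ** transpose P ** msqrt CV))" for X
  have "?I ** D ** ?I = (?I ** T) ** CP ** (T ** ?I)"
    unfolding D by (simp only: matrix_mul_assoc)
  then have h1: "transpose (msqrt CP) ** msqrt CP = ?I ** D ** ?I"
    using I Q by simp
  have h2: "transpose (msqrt CV ** P) ** (msqrt CV ** P) = K ** D ** K"
    using KD V by (simp add: matrix_transpose_mul matrix_mul_assoc) (metis matrix_mul_assoc)
  have u1: "2 * F1 C \<le> trace (?I ** C) + trace (?I ** D)"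
    using trace_msqrt_le[OF C I(1) pD h1] Q by (simp add: F1_def)
  have l1: "trace (?I ** D) \<le> F1 D"
    using trace_msqrt_ge[OF I(1) pD h1] Q by (simp add: F1_def)
  have u2: "2 * F2 C \<le> trace (K ** C) + trace (K ** D)"
    using trace_msqrt_le[OF C K pD h2] V by (simp add: F2_def matrix_transpose_mul matrix_mul_assoc)
  have l2: "trace (K ** D) \<le> F2 D"
    using trace_msqrt_ge[OF K pD h2] V by (simp add: F2_def matrix_transpose_mul matrix_mul_assoc)
  \<comment> \<open>Pairing \<open>stat\<close> with \<open>X\<close> turns the linear terms of the
    functional into those of the supporting bounds.\<close>
  have st: "trace X + lam * trace (P ** X ** transpose P) = trace (?I ** X) + lam * trace (K ** X)" for X
  proof -
    have "trace ((?I + lam *\<^sub>R K) ** X) = trace ((mat 1 + lam *\<^sub>R (transpose P ** P)) ** X)"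
      unfolding stat ..
    moreover have "trace (P ** X ** transpose P) = trace (transpose P ** P ** X)"
      using trace_mul_sym[of "P ** X" "transpose P"] by (simp add: matrix_mul_assoc)
    ultimately show ?thesis
      by (simp add: matrix_add_rdistrib trace_add trace_scaleR flip: scalar_matrix_assoc)
  qed
  have expand: "trace (CP + X - 2 *\<^sub>R msqrt (msqrt CP ** X ** msqrt CP))
      + lam * trace (CV + P ** X ** transpose P
          - 2 *\<^sub>R msqrt (msqrt CV ** P ** X ** transpose P ** msqrt CV))
     = trace CP + lam * trace CV + (trace (?I ** X) + lam * trace (K ** X)) - 2 * F1 X - lam * (2 * F2 X)" for X
    unfolding st[symmetric] F1_def F2_def
    by (simp add: trace_add trace_sub trace_scaleR algebra_simps)
  \<comment> \<open>Both sides are compared with \<open>trace CP + lam * trace CV - trace (?I ** D)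
    - lam * trace (K ** D)\<close>: \<open>u1\<close> and \<open>u2\<close> put the value at
    \<open>C\<close> above it, \<open>l1\<close> and \<open>l2\<close> the value at \<open>D\<close>
    below it.\<close>
  show ?thesis unfolding expand
    using u1 l1 mult_left_mono[OF u2 lam] mult_left_mono[OF l2 lam]
    by (simp add: algebra_simps)
qed

section \<open>Verification of the closed form\<close>

theorem theorem5p1:
  fixes \<mu>\<^sub>P :: "real^'na" and \<nu>\<^sub>V :: "real^'nv"
    and C\<^sub>P :: "real^'na^'na" and C\<^sub>V :: "real^'nv^'nv"
    and P :: "real^'na^'nv" and lam :: real
    and m_star :: "real^'na" and W A B C_star :: "real^'na^'na"
  assumes "C\<^sub>P \<in> Sym_pp" and "C\<^sub>V \<in> Sym_pp" and "0 \<le> lam"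
    and "W = matrix_inv (mat 1 + lam *\<^sub>R (transpose P ** P))"
    and "m_star = W *v (\<mu>\<^sub>P + lam *\<^sub>R (transpose P *v \<nu>\<^sub>V))"
    and "A = W ** C\<^sub>P ** W"
    and "B = lam *\<^sub>R (W ** matrix_inv (msqrt A)
               ** msqrt (msqrt A ** transpose P ** C\<^sub>V ** P ** msqrt A)
               ** matrix_inv (msqrt A) ** W)"
    and "C_star = (W + B) ** C\<^sub>P ** (W + B)"
  shows "transpose W = W \<and> transpose B = B \<and>
    is_arg_min (\<lambda>(m, C). L_GWB \<mu>\<^sub>P C\<^sub>P \<nu>\<^sub>V C\<^sub>V P lam m C)
      (\<lambda>(m, C). (m, C) \<in> UNIV \<times> Sym_pp) (m_star, C_star)"
proof -
  note lam = assms(3)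
  define J where "J = mat 1 + lam *\<^sub>R (transpose P ** P)"
  have one: "mat 1 \<in> (Sym_pp :: (real^'na^'na) set)" by (simp add: Sym_pp_def)
  have "J \<in> Sym_pp" unfolding J_def by (intro Sym_pp_add one psd_scaleR psd_gram lam)
  then have W: "W \<in> Sym_pp" "J ** W = mat 1" "W ** J = mat 1"
    using Sym_pp_inv assms(4) by (auto simp: J_def Sym_pp_iff invertible_inv)
  then have pW: "psd W" "transpose W = W" by (simp_all add: Sym_pp_iff psd_sym)
  have A: "A \<in> Sym_pp" unfolding assms(6) by (intro Sym_pp_congruence assms W)
  define S where "S = msqrt A"
  define Si where "Si = matrix_inv S"
  have S: "S \<in> Sym_pp" using msqrt_Sym_pp[OF A] by (simp add: S_def)
  then have S': "transpose S = S" "S ** Si = mat 1" "Si ** S = mat 1"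
    by (simp_all add: Sym_pp_iff psd_sym invertible_inv Si_def)
  have SS: "S ** S = A" using A by (simp add: S_def Sym_pp_iff msqrt)
  have Si: "psd Si" "transpose Si = Si" using Sym_pp_inv[OF S] by (simp_all add: Si_def Sym_pp_iff psd_sym)
  define E where "E = transpose P ** C\<^sub>V ** P"
  have CV: "psd C\<^sub>V" using assms(2) by (simp add: Sym_pp_iff)
  have E: "psd E" unfolding E_def by (rule psd_congruence[OF CV])
  have SES: "psd (S ** E ** S)" using psd_congruence[OF E, of S] S' by simp
  define N where "N = msqrt (S ** E ** S)"
  have N: "psd N" "N ** N = S ** E ** S" using msqrt[OF SES] by (simp_all add: N_def)
  \<comment> \<open>The matrix of the optimal transport map from covariance \<open>A\<close> to the
    possibly degenerate \<open>E\<close>, that is, the solution of the Riccati equation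
    \<open>L ** A ** L = E\<close>.\<close>
  define L where "L = Si ** N ** Si"
  have L: "psd L" using psd_congruence[OF N(1), of Si] Si by (simp add: L_def)
  have "L ** A ** L = Si ** N ** (Si ** S) ** (S ** Si) ** N ** Si"
    unfolding L_def SS[symmetric] by (simp only: matrix_mul_assoc)
  also have "\<dots> = Si ** (N ** N) ** Si" using S' by (simp add: matrix_mul_assoc)
  also have "\<dots> = (Si ** S) ** E ** (S ** Si)" unfolding N(2) by (simp only: matrix_mul_assoc)
  finally have LAL: "L ** A ** L = E" using S' by simp
  have BL: "B = lam *\<^sub>R (W ** L ** W)"
    unfolding assms(7) L_def N_def E_def Si_def S_def by (simp only: matrix_mul_assoc)
  have WLW: "psd (W ** L ** W)" using psd_congruence[OF L, of W] pW by simp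
  have B: "psd B" unfolding BL by (intro psd_scaleR WLW lam)
  define T where "T = W + B"
  have T: "T \<in> Sym_pp" unfolding T_def by (intro Sym_pp_add W B)
  define Ti where "Ti = matrix_inv T"
  have T': "transpose T = T" "T ** Ti = mat 1" "Ti ** T = mat 1"
    using T by (simp_all add: Sym_pp_iff psd_sym invertible_inv Ti_def)
  have Ti: "transpose Ti = Ti" using Sym_pp_inv[OF T] by (simp add: Sym_pp_iff psd_sym Ti_def)
  \<comment> \<open>Forced by the slope identity:
    \<open>J ** T = mat 1 + lam *\<^sub>R (L ** W)\<close>, so \<open>lam *\<^sub>R K\<close> must
    be what remains of \<open>J\<close> after subtracting \<open>Ti\<close>.\<close>
  define K where "K = L ** W ** Ti"
  have KT: "K ** T = L ** W" using T'(3) by (simp add: K_def matrix_mul_assoc[symmetric])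
  have LW: "transpose (L ** W) = W ** L" using psd_sym[OF L] pW by (simp add: matrix_transpose_mul)
  \<comment> \<open>\<open>K\<close> is not visibly symmetric, but it is the congruence by
    \<open>Ti\<close> of this matrix, which is a sum of two positive semidefinite terms.\<close>
  have TLW: "psd (T ** (L ** W))"
  proof -
    have "psd (L ** W ** L)" using psd_congruence[OF pW(1), of L] psd_sym[OF L] by simp
    then have "psd (W ** (L ** W ** L) ** W)" using psd_congruence[of "L ** W ** L" W] pW by simp
    moreover have "T ** (L ** W) = W ** L ** W + lam *\<^sub>R (W ** (L ** W ** L) ** W)"
      by (simp add: T_def BL matrix_add_rdistrib matrix_mul_assoc flip: scalar_matrix_assoc)
    ultimately show ?thesis by (simp add: psd_add psd_scaleR WLW lam)
  qed
  have "Ti ** (T ** (L ** W)) ** Ti = (Ti ** T) ** K" by (simp only: K_def matrix_mul_assoc)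
  then have "K = transpose Ti ** (T ** (L ** W)) ** Ti" using T' Ti by simp
  then have K: "psd K" using psd_congruence[OF TLW, of Ti] by simp
  have TK: "T ** K = W ** L"
    using arg_cong[OF KT, of transpose] by (simp add: matrix_transpose_mul psd_sym K T' L pW)
  have "K ** C_star ** K = (K ** T) ** C\<^sub>P ** (T ** K)"
    unfolding assms(8) T_def[symmetric] by (simp only: matrix_mul_assoc)
  also have "\<dots> = L ** A ** L" unfolding KT TK assms(6) by (simp only: matrix_mul_assoc)
  finally have KD: "K ** C_star ** K = transpose P ** C\<^sub>V ** P" using LAL by (simp add: E_def)
  \<comment> \<open>The slope identity is checked after right multiplication by \<open>T\<close>,
    which is then cancelled.\<close>
  have "(Ti + lam *\<^sub>R K) ** T = mat 1 + lam *\<^sub>R (L ** W)"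
    using T' by (simp add: matrix_add_rdistrib KT flip: scalar_matrix_assoc)
  moreover have "J ** T = mat 1 + lam *\<^sub>R (L ** W)"
    using W(2) by (simp add: T_def BL matrix_add_ldistrib matrix_scalar_ac matrix_mul_assoc
        flip: scalar_matrix_assoc)
  ultimately have "(Ti + lam *\<^sub>R K) ** T ** Ti = J ** T ** Ti" by simp
  then have stat: "Ti + lam *\<^sub>R K = J" using T' by (simp add: matrix_mul_assoc[symmetric])
  have Cs: "C_star = T ** C\<^sub>P ** T" by (simp add: assms(8) T_def)
  have CsP: "C_star \<in> Sym_pp" unfolding Cs by (intro Sym_pp_congruence assms T)
  have min: "L_GWB \<mu>\<^sub>P C\<^sub>P \<nu>\<^sub>V C\<^sub>V P lam m_star C_star \<le> L_GWB \<mu>\<^sub>P C\<^sub>P \<nu>\<^sub>V C\<^sub>V P lam m C"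
    if "C \<in> Sym_pp" for m C
  proof -
    have "J *v m_star = \<mu>\<^sub>P + lam *\<^sub>R (transpose P *v \<nu>\<^sub>V)"
      unfolding assms(5) using W(2) by (simp add: matrix_vector_mul_assoc)
    from quadratic_minimizer[OF lam this[unfolded J_def], of m]
      covariance_minimizer[OF lam assms(1) CV _ T K Cs KD stat[unfolded J_def Ti_def], of C]
    show ?thesis using that by (simp add: L_GWB_def Sym_pp_iff algebra_simps)
  qed
  show ?thesis
    using pW psd_sym[OF B] CsP min by (auto simp: is_arg_min_linorder)
qed

end
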